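(* Let $1 \leq s \leq n$ be integers and let $F_i, F_j \in V_s(\mathbb{R}^n)$. Then the cone distance equals the chordal distance up to a scalar factor: $$d_{\mathrm{cone}}(F_i,F_j) = \sqrt{2}\, d_{\mathrm{chord}}(F_i,F_j).$$
   Context: $V_s(\mathbb{R}^n) := \{A \in \mathbb{R}^{n\times s} : A^T A = I_s\}$ is the set of $n\times s$ real matrices with orthonormal columns, and $\|X\|_F^2 = \mathrm{trace}(X^T X)$ is the squared Frobenius norm. Cone distance: for $F_i,F_j \in V_s(\mathbb{R}^n)$ with associated sub-cones $C_s(F_k) = \{F_k Y F_k^T : Y \in \mathbb{S}^s_+\}$ of the cone $\mathbb{S}^n_+$ of real positive semidefinite $n\times n$ matrices, the distance between the two sub-cones, as a function of $(F_i,F_j)$, is $$d_{\mathrm{cone}}(F_i,F_j) := \| F_i I_s F_i^T - F_j I_s F_j^T \|_F .$$ Principal angles: for $s$-dimensional subspaces $\mathcal{S},\mathcal{T}$ of $\mathbb{R}^n$, the principal angles $\theta_1,\dots,\theta_s \in [0,\pi/2]$ are defined successively by $\cos\theta_i = \max_{u\in\mathcal{S}} \max_{v \in \mathcal{T}} u\cdot v = u_i\cdot v_i$, subject to $u\cdot u = v\cdot v = 1$ and $u\cdot u_j = 0$, $v\cdot v_j = 0$ for $1 \leq j \leq i-1$. Equivalently, if the columns of $S,T \in \mathbb{R}^{n\times s}$ form orthonormal bases of $\mathcal{S},\mathcal{T}$, then $\cos\theta_1,\dots,\cos\theta_s$ are the singular values of $S^T T$ in non-increasing order. Chordal distance: for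 $S,T \in V_s(\mathbb{R}^n)$ whose columns are orthonormal bases of $\mathcal{S},\mathcal{T}$, with principal angles $\theta_1,\dots,\theta_s$ between $\mathcal{S}$ and $\mathcal{T}$, $$d_{\mathrm{chord}}(S,T) := \sqrt{\sin^2\theta_1 + \dots + \sin^2\theta_s} = \big[s - \|S^T T\|_F^2\big]^{1/2}.$$ *)

theory Defs
  imports "HOL-Analysis.Analysis"
begin

definition stiefel :: "(real ^ 's ^ 'n) set" where
  "stiefel = {A. transpose A ** A = mat 1}"

definition frobenius_norm :: "real ^ 's ^ 'n \<Rightarrow> real" where
  "frobenius_norm X = sqrt (trace (transpose X ** X))"

definition d_cone :: "real ^ 's ^ 'n \<Rightarrow> real ^ 's ^ 'n \<Rightarrow> real" where
  "d_cone F G =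
     frobenius_norm (F ** (mat 1 :: real ^ 's ^ 's) ** transpose F
                     - G ** (mat 1 :: real ^ 's ^ 's) ** transpose G)"

definition feasible_pairs ::
  "'a set \<Rightarrow> 'a set \<Rightarrow> (nat \<Rightarrow> 'a) \<Rightarrow> (nat \<Rightarrow> 'a) \<Rightarrow> nat \<Rightarrow> ('a::euclidean_space \<times> 'a) set"
  where
  "feasible_pairs U V u v i =
     {(x, y). x \<in> U \<and> y \<in> V \<and> x \<bullet> x = 1 \<and> y \<bullet> y = 1 \<and>
              (\<forall>j\<in>{1..<i}. x \<bullet> u j = 0 \<and> y \<bullet> v j = 0)}"

text \<open>
  Meant for subspaces \<open>U\<close>, \<open>V\<close> of the same dimension \<open>s\<close>. The values of \<open>\<theta>\<close> outside
  \<open>{1..s}\<close> are irrelevant. This is a relation and not a function because the principal vectors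
  \<open>u i\<close>, \<open>v i\<close> attaining the successive maxima need not be unique.
\<close>

definition principal_angles ::
  "nat \<Rightarrow> 'a::euclidean_space set \<Rightarrow> 'a set \<Rightarrow> (nat \<Rightarrow> real) \<Rightarrow> bool" where
  "principal_angles s U V \<theta> \<longleftrightarrow>
     (\<exists>u v. \<forall>i\<in>{1..s}.
        0 \<le> \<theta> i \<and> \<theta> i \<le> pi / 2 \<and>
        (u i, v i) \<in> feasible_pairs U V u v i \<and>
        (\<forall>(x, y)\<in>feasible_pairs U V u v i. x \<bullet> y \<le> u i \<bullet> v i) \<and>
        cos (\<theta> i) = u i \<bullet> v i)"

text \<open>
  The description is proper for \<open>S\<close>, \<open>T\<close> in \<^const>\<open>stiefel\<close>: principal angles then exist, and
  the sum does not depend on the choice of principal vectors.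
\<close>

definition d_chord :: "real ^ 's ^ 'n \<Rightarrow> real ^ 's ^ 'n \<Rightarrow> real" where
  "d_chord S T =
     (THE d. \<exists>\<theta>. principal_angles CARD('s) (span (columns S)) (span (columns T)) \<theta> \<and>
                 d = sqrt (\<Sum>i=1..CARD('s). (sin (\<theta> i))\<^sup>2))"

end

theory Submission
  imports Defs
begin

text \<open>
  Expanding the square gives \<open>d_cone\<^sup>2 = 2s - 2 \<Sum>\<^sub>a\<^sub>b (S\<^sub>a \<bullet> T\<^sub>b)\<^sup>2\<close>, where \<open>S\<^sub>a\<close>, \<open>T\<^sub>b\<close> are the
  columns. The double sum depends only on the two column spaces, so the columns may be replaced by
  principal vectors \<open>u\<^sub>i\<close>, \<open>v\<^sub>j\<close>. Rotating \<open>v\<^sub>i\<close> towards \<open>v\<^sub>j\<close> (\<open>j > i\<close>) stays feasible in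
  step \<open>i\<close>, so maximality of \<open>u\<^sub>i \<bullet> v\<^sub>i\<close> forces \<open>u\<^sub>i \<bullet> v\<^sub>j = 0\<close>; symmetrically \<open>u\<^sub>j \<bullet> v\<^sub>i = 0\<close>.
  Hence the double sum is \<open>\<Sum>\<^sub>i cos\<^sup>2 \<theta>\<^sub>i\<close>.
\<close>

section \<open>Orthonormal families and their spans\<close>

text \<open>Indexed families instead of sets, with an arbitrary index type: matrix columns are
  indexed by a finite type, principal vectors by \<open>{1..s}\<close>, and both have to be
  compared.\<close>

definition orthonormal_on :: "'i set \<Rightarrow> ('i \<Rightarrow> 'a::real_inner) \<Rightarrow> bool" where
  "orthonormal_on I f \<longleftrightarrow> (\<forall>i\<in>I. \<forall>j\<in>I. f i \<bullet> f j = (if i = j then 1 else 0))"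

lemma orthonormal_on_inj_on: "orthonormal_on I f \<Longrightarrow> inj_on f I"
  unfolding orthonormal_on_def inj_on_def by (metis zero_neq_one)

lemma orthonormal_on_pairwise_orthogonal:
  "orthonormal_on I f \<Longrightarrow> pairwise orthogonal (f ` I)"
  unfolding orthonormal_on_def pairwise_def orthogonal_def by auto

lemma orthonormal_on_norm: "orthonormal_on I f \<Longrightarrow> i \<in> I \<Longrightarrow> norm (f i) = 1"
  unfolding orthonormal_on_def by (simp add: norm_eq_1)

lemma orthonormal_on_independent:
  fixes f :: "'i \<Rightarrow> 'a::euclidean_space"
  assumes "orthonormal_on I f"
  shows "independent (f ` I)"
proof (rule pairwise_orthogonal_independent)
  show "pairwise orthogonal (f ` I)"
    using assms by (rule orthonormal_on_pairwise_orthogonal)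
  show "0 \<notin> f ` I"
    using orthonormal_on_norm[OF assms] by fastforce
qed

lemma orthonormal_on_dim:
  fixes f :: "'i \<Rightarrow> 'a::euclidean_space"
  assumes "orthonormal_on I f"
  shows "dim (span (f ` I)) = card I"
  using orthonormal_on_independent[OF assms] orthonormal_on_inj_on[OF assms]
  by (simp add: dim_eq_card_independent card_image)

text \<open>Equal dimensions leave no room between the span and \<open>U\<close>. This is how
  principal vectors, which are only chosen inside the column spaces, turn out to be bases of
  them.\<close>

lemma orthonormal_on_span_eq:
  fixes f :: "'i \<Rightarrow> 'a::euclidean_space"
  assumes "orthonormal_on I f" and "f ` I \<subseteq> U" and "subspace U" and "dim U = card I"
  shows "span (f ` I) = U"
proof (rule subspace_dim_equal)
  show "span (f ` I) \<subseteq> U"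
    using assms by (simp add: span_minimal)
qed (use assms orthonormal_on_dim[OF assms(1)] in auto)

lemma orthonormal_on_expand:
  fixes f :: "'i \<Rightarrow> 'a::euclidean_space"
  assumes "orthonormal_on I f" and "finite I" and "x \<in> span (f ` I)"
  shows "x = (\<Sum>i\<in>I. (x \<bullet> f i) *\<^sub>R f i)"
proof -
  have "(\<Sum>b\<in>f ` I. (x \<bullet> b) *\<^sub>R b) = x"
    using assms orthonormal_on_pairwise_orthogonal orthonormal_on_norm
    by (intro orthonormal_basis_expand) fastforce+
  then show ?thesis
    using orthonormal_on_inj_on[OF assms(1)] by (simp add: sum.reindex)
qed

text \<open>Both sides are the squared length of the orthogonal projection of \<open>x\<close> onto
  the common span. The proof expands each family in the other and exchanges the two sums.\<close>

lemma sum_inner_square_basis_independent: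
  fixes f :: "'i \<Rightarrow> 'a::euclidean_space" and g :: "'j \<Rightarrow> 'a"
  assumes f: "orthonormal_on I f" "finite I" and g: "orthonormal_on J g" "finite J"
    and span: "span (f ` I) = span (g ` J)"
  shows "(\<Sum>i\<in>I. (x \<bullet> f i)\<^sup>2) = (\<Sum>j\<in>J. (x \<bullet> g j)\<^sup>2)"
proof -
  have fx: "x \<bullet> f i = (\<Sum>j\<in>J. (f i \<bullet> g j) * (x \<bullet> g j))" if "i \<in> I" for i
  proof -
    have "f i = (\<Sum>j\<in>J. (f i \<bullet> g j) *\<^sub>R g j)"
      using that span by (intro orthonormal_on_expand g) (metis imageI span_base)
    then have "x \<bullet> f i = x \<bullet> (\<Sum>j\<in>J. (f i \<bullet> g j) *\<^sub>R g j)"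
      by simp
    then show ?thesis
      by (simp add: inner_sum_right)
  qed
  have gx: "x \<bullet> g j = (\<Sum>i\<in>I. (g j \<bullet> f i) * (x \<bullet> f i))" if "j \<in> J" for j
  proof -
    have "g j = (\<Sum>i\<in>I. (g j \<bullet> f i) *\<^sub>R f i)"
      using that span by (intro orthonormal_on_expand f) (metis imageI span_base)
    then have "x \<bullet> g j = x \<bullet> (\<Sum>i\<in>I. (g j \<bullet> f i) *\<^sub>R f i)"
      by simp
    then show ?thesis
      by (simp add: inner_sum_right)
  qed
  have "(\<Sum>i\<in>I. (x \<bullet> f i)\<^sup>2) = (\<Sum>i\<in>I. (x \<bullet> f i) * (\<Sum>j\<in>J. (f i \<bullet> g j) * (x \<bullet> g j)))"
    using fx by (simp add: power2_eq_square)
  also have "\<dots> = (\<Sum>i\<in>I. \<Sum>j\<in>J. (x \<bullet> f i) * ((f i \<bullet> g j) * (x \<bullet> g j)))"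
    by (simp add: sum_distrib_left)
  also have "\<dots> = (\<Sum>j\<in>J. \<Sum>i\<in>I. (x \<bullet> f i) * ((f i \<bullet> g j) * (x \<bullet> g j)))"
    by (rule sum.swap)
  also have "\<dots> = (\<Sum>j\<in>J. (x \<bullet> g j) * (\<Sum>i\<in>I. (g j \<bullet> f i) * (x \<bullet> f i)))"
    by (simp add: sum_distrib_left inner_commute mult_ac)
  also have "\<dots> = (\<Sum>j\<in>J. (x \<bullet> g j)\<^sup>2)"
    using gx by (simp add: power2_eq_square)
  finally show ?thesis .
qed

section \<open>Stiefel matrices and the cone distance in terms of columns\<close>

lemma stiefel_orthonormal_columns:
  "A \<in> stiefel \<Longrightarrow> orthonormal_on UNIV (\<lambda>i. column i A)"
  by (simp add: stiefel_def orthonormal_on_def matrix_mult_transpose_dot_column vec_eq_iff mat_def)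

lemma columns_eq_range: "columns A = range (\<lambda>i. column i A)"
  by (auto simp: columns_def)

lemma stiefel_dim_span_columns:
  fixes A :: "real ^ 's ^ 'n"
  assumes "A \<in> stiefel"
  shows "dim (span (columns A)) = CARD('s)"
  unfolding columns_eq_range by (rule orthonormal_on_dim[OF stiefel_orthonormal_columns[OF assms]])

text \<open>Cyclicity of the trace turns the left side into \<open>trace (M ** transpose M)\<close>
  for \<open>M = transpose S ** T\<close>, the squared Frobenius norm of the matrix of inner
  products of columns.\<close>

lemma trace_projection_product:
  fixes S T :: "real ^ 's ^ 'n"
  shows "trace ((S ** transpose S) ** (T ** transpose T)) =
         (\<Sum>a\<in>UNIV. \<Sum>b\<in>UNIV. (column a S \<bullet> column b T)\<^sup>2)"
proof -
  let ?M = "transpose S ** T"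
  have entry: "?M $ a $ b = column a S \<bullet> column b T" for a b
    by (simp add: matrix_matrix_mult_def transpose_def column_def inner_vec_def)
  have "trace ((S ** transpose S) ** (T ** transpose T)) = trace (S ** (?M ** transpose T))"
    by (simp add: matrix_mul_assoc)
  also have "\<dots> = trace (?M ** (transpose T ** S))"
    by (subst trace_mul_sym) (simp add: matrix_mul_assoc)
  also have "transpose T ** S = transpose ?M"
    by (simp add: matrix_transpose_mul)
  also have "trace (?M ** transpose ?M) = (\<Sum>a\<in>UNIV. \<Sum>b\<in>UNIV. (?M $ a $ b)\<^sup>2)"
    unfolding trace_def by (simp add: matrix_matrix_mult_def[of ?M] transpose_def[of ?M] power2_eq_square)
  finally show ?thesis
    by (simp add: entry)
qed

text \<open>\<open>P\<close> and \<open>Q\<close> below are the orthogonal projections onto the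
  column spaces: symmetric, idempotent and of trace \<open>CARD('s)\<close>. Hence only the mixed
  term \<open>trace (P ** Q)\<close>, counted twice, depends on the relative position of the
  spaces.\<close>

lemma d_cone_eq:
  fixes S T :: "real ^ 's ^ 'n"
  assumes S: "S \<in> stiefel" and T: "T \<in> stiefel"
  shows "d_cone S T =
         sqrt (2 * (real CARD('s) - (\<Sum>a\<in>UNIV. \<Sum>b\<in>UNIV. (column a S \<bullet> column b T)\<^sup>2)))"
proof -
  define P where "P = S ** transpose S"
  define Q where "Q = T ** transpose T"
  have idem: "(A ** transpose A) ** (A ** transpose A) = A ** transpose A"
    if "A \<in> stiefel" for A :: "real ^ 's ^ 'n"
    using that unfolding stiefel_def
    by (metis (mono_tags, lifting) matrix_mul_assoc matrix_mul_rid mem_Collect_eq)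
  have tr: "trace (A ** transpose A) = real CARD('s)" if "A \<in> stiefel" for A :: "real ^ 's ^ 'n"
    using that unfolding stiefel_def by (subst trace_mul_sym) (simp add: trace_I)
  have sym: "transpose (P - Q) = P - Q"
    by (simp add: P_def Q_def vec_eq_iff transpose_def matrix_matrix_mult_def mult.commute)
  have "(P - Q) ** (P - Q) = P ** P - P ** Q - (Q ** P - Q ** Q)"
    by (simp add: matrix_matrix_mult_def vec_eq_iff sum_subtractf sum.distrib algebra_simps)
  then have "trace (transpose (P - Q) ** (P - Q)) =
      trace (P ** P) - trace (P ** Q) - (trace (Q ** P) - trace (Q ** Q))"
    by (simp add: sym trace_sub)
  also have "\<dots> = 2 * (real CARD('s) - trace (P ** Q))"
    using idem tr S T trace_mul_sym[of Q P] by (simp add: P_def Q_def)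
  finally show ?thesis
    unfolding d_cone_def frobenius_norm_def
    by (simp add: trace_projection_product P_def Q_def)
qed

section \<open>Biorthogonality of principal vectors and the sum of squared sines\<close>

text \<open>With \<open>p = x \<bullet> y\<close> and \<open>q = x \<bullet> z\<close>, the linear
  form \<open>a * p + b * q\<close> has maximum \<open>sqrt (p\<^sup>2 + q\<^sup>2)\<close> on the
  unit circle, which exceeds \<open>p\<close> unless \<open>q = 0\<close>.\<close>

lemma inner_zero_if_max_on_rotations:
  fixes x y z :: "'a::real_inner"
  assumes max: "\<And>a b. a\<^sup>2 + b\<^sup>2 = 1 \<Longrightarrow> x \<bullet> (a *\<^sub>R y + b *\<^sub>R z) \<le> x \<bullet> y"
  shows "x \<bullet> z = 0"
proof (rule ccontr)
  assume nz: "x \<bullet> z \<noteq> 0"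
  define p q where "p = x \<bullet> y" and "q = x \<bullet> z"
  define r where "r = sqrt (p\<^sup>2 + q\<^sup>2)"
  have r2: "r\<^sup>2 = p\<^sup>2 + q\<^sup>2"
    by (simp add: r_def)
  have q2: "q\<^sup>2 > 0"
    using nz by (simp add: q_def)
  have r: "r > 0"
    unfolding r_def using q2 by (simp add: add_nonneg_pos)
  \<comment> \<open>The point of the circle in the direction of \<open>(p, q)\<close>, where the
    linear form takes its maximum \<open>r\<close>.\<close>
  have "(p / r)\<^sup>2 + (q / r)\<^sup>2 = 1"
    using r by (simp add: power_divide add_divide_distrib[symmetric] r2[symmetric])
  from max[OF this] have "p / r * p + q / r * q \<le> p"
    by (simp add: inner_add_right p_def q_def)
  moreover have "p / r * p + q / r * q = r"
    using r r2 by (simp add: field_simps power2_eq_square)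
  ultimately have "r\<^sup>2 \<le> p\<^sup>2"
    using r by (simp add: power_mono)
  then show False
    using r2 q2 by simp
qed

lemma rotation_inner_self:
  fixes y z :: "'a::real_inner"
  assumes "y \<bullet> y = 1" "z \<bullet> z = 1" "y \<bullet> z = 0" "a\<^sup>2 + b\<^sup>2 = 1"
  shows "(a *\<^sub>R y + b *\<^sub>R z) \<bullet> (a *\<^sub>R y + b *\<^sub>R z) = 1"
  using assms by (simp add: inner_add_left inner_add_right inner_commute power2_eq_square)

lemma feasible_pairs_orthonormal_on:
  assumes "\<forall>i\<in>{1..s}. (u i, v i) \<in> feasible_pairs U V u v i"
  shows "orthonormal_on {1..s} u" and "orthonormal_on {1..s} v"
proof -
  have lt: "u i \<bullet> u j = 0 \<and> v i \<bullet> v j = 0" if "i \<in> {1..s}" "j \<in> {1..s}" "j < i" for i j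
    using assms that by (auto simp: feasible_pairs_def)
  have self: "u i \<bullet> u i = 1 \<and> v i \<bullet> v i = 1" if "i \<in> {1..s}" for i
    using assms that by (auto simp: feasible_pairs_def)
  show "orthonormal_on {1..s} u" "orthonormal_on {1..s} v"
    unfolding orthonormal_on_def using lt self by (metis inner_commute linorder_neqE_nat)+
qed

lemma principal_vectors_cross_zero:
  assumes subsp: "subspace U" "subspace V"
    and feas: "\<forall>i\<in>{1..s}. (u i, v i) \<in> feasible_pairs U V u v i"
    and max: "\<forall>i\<in>{1..s}. \<forall>(x, y)\<in>feasible_pairs U V u v i. x \<bullet> y \<le> u i \<bullet> v i"
    and ij: "1 \<le> i" "i < j" "j \<le> s"
  shows "u i \<bullet> v j = 0" and "u j \<bullet> v i = 0"
proof -
  have i: "i \<in> {1..s}" and j: "j \<in> {1..s}"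
    using ij by auto
  have fi: "u i \<in> U" "v i \<in> V" "u i \<bullet> u i = 1" "v i \<bullet> v i = 1"
      "\<And>k. k \<in> {1..<i} \<Longrightarrow> u i \<bullet> u k = 0 \<and> v i \<bullet> v k = 0"
    using feas i unfolding feasible_pairs_def by blast+
  have fj: "u j \<in> U" "v j \<in> V" "u j \<bullet> u j = 1" "v j \<bullet> v j = 1"
      "\<And>k. k \<in> {1..<j} \<Longrightarrow> u j \<bullet> u k = 0 \<and> v j \<bullet> v k = 0"
    using feas j unfolding feasible_pairs_def by blast+
  \<comment> \<open>The constraints of step \<open>j\<close> include those of step \<open>i\<close>,
    since \<open>i < j\<close>; so combining the vectors of step \<open>i\<close> with those of step
    \<open>j\<close> respects the constraints of step \<open>i\<close>.\<close>
  have fjk: "u j \<bullet> u k = 0 \<and> v j \<bullet> v k = 0" if "k \<in> {1..<i}" for k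
    using fj(5)[of k] that ij by auto
  have ortho: "u i \<bullet> u j = 0" "v i \<bullet> v j = 0"
    using fj(5)[of i] ij by (auto simp: inner_commute)
  show "u i \<bullet> v j = 0"
  proof (rule inner_zero_if_max_on_rotations)
    fix a b :: real
    assume ab: "a\<^sup>2 + b\<^sup>2 = 1"
    have "(u i, a *\<^sub>R v i + b *\<^sub>R v j) \<in> feasible_pairs U V u v i"
      unfolding feasible_pairs_def
      using fi fj fjk subsp rotation_inner_self[OF fi(4) fj(4) ortho(2) ab]
      by (auto simp: subspace_add subspace_scale inner_add_left)
    then show "u i \<bullet> (a *\<^sub>R v i + b *\<^sub>R v j) \<le> u i \<bullet> v i"
      using max i by blast
  qed
  \<comment> \<open>Now \<open>v i\<close> is kept and \<open>u i\<close> is rotated towards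
    \<open>u j\<close>; step \<open>i\<close> is again the one whose maximality is used.\<close>
  have "v i \<bullet> u j = 0"
  proof (rule inner_zero_if_max_on_rotations)
    fix a b :: real
    assume ab: "a\<^sup>2 + b\<^sup>2 = 1"
    have "(a *\<^sub>R u i + b *\<^sub>R u j, v i) \<in> feasible_pairs U V u v i"
      unfolding feasible_pairs_def
      using fi fj fjk subsp rotation_inner_self[OF fi(3) fj(3) ortho(1) ab]
      by (auto simp: subspace_add subspace_scale inner_add_left)
    then have "(a *\<^sub>R u i + b *\<^sub>R u j) \<bullet> v i \<le> u i \<bullet> v i"
      using max i by blast
    then show "v i \<bullet> (a *\<^sub>R u i + b *\<^sub>R u j) \<le> v i \<bullet> u i"
      by (simp add: inner_commute)
  qed
  then show "u j \<bullet> v i = 0"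
    by (simp add: inner_commute)
qed

lemma sum_sin_square_principal_angles:
  fixes S T :: "real ^ 's ^ 'n"
  assumes S: "S \<in> stiefel" and T: "T \<in> stiefel"
    and "principal_angles CARD('s) (span (columns S)) (span (columns T)) \<theta>"
  shows "(\<Sum>i=1..CARD('s). (sin (\<theta> i))\<^sup>2) =
         real CARD('s) - (\<Sum>a\<in>UNIV. \<Sum>b\<in>UNIV. (column a S \<bullet> column b T)\<^sup>2)"
proof -
  let ?U = "span (columns S)" and ?V = "span (columns T)" and ?I = "{1..CARD('s)}"
  obtain u v where uv: "\<forall>i\<in>?I. (u i, v i) \<in> feasible_pairs ?U ?V u v i"
      "\<forall>i\<in>?I. \<forall>(x, y)\<in>feasible_pairs ?U ?V u v i. x \<bullet> y \<le> u i \<bullet> v i"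
      "\<forall>i\<in>?I. cos (\<theta> i) = u i \<bullet> v i"
    using assms(3) unfolding principal_angles_def by blast
  note on_u = feasible_pairs_orthonormal_on(1)[OF uv(1)]
    and on_v = feasible_pairs_orthonormal_on(2)[OF uv(1)]
    and on_S = stiefel_orthonormal_columns[OF S] and on_T = stiefel_orthonormal_columns[OF T]
  have span_u: "span (u ` ?I) = ?U"
    using uv(1) stiefel_dim_span_columns[OF S]
    by (intro orthonormal_on_span_eq on_u) (auto simp: feasible_pairs_def)
  have span_v: "span (v ` ?I) = ?V"
    using uv(1) stiefel_dim_span_columns[OF T]
    by (intro orthonormal_on_span_eq on_v) (auto simp: feasible_pairs_def)
  have cross: "v j \<bullet> u i = (if i = j then cos (\<theta> i) else 0)" if "i \<in> ?I" "j \<in> ?I" for i j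
  proof (cases i j rule: linorder_cases)
    case less
    then show ?thesis
      using principal_vectors_cross_zero(1)[OF subspace_span subspace_span uv(1,2), of i j] that
      by (simp add: inner_commute)
  next
    case equal
    then show ?thesis
      using uv(3) that by (simp add: inner_commute)
  next
    case greater
    then show ?thesis
      using principal_vectors_cross_zero(2)[OF subspace_span subspace_span uv(1,2), of j i] that
      by (simp add: inner_commute)
  qed
  \<comment> \<open>The bases are exchanged one at a time: the columns of \<open>T\<close> for
    \<open>v\<close> with the column of \<open>S\<close> fixed, then, after swapping the sums, the
    columns of \<open>S\<close> for \<open>u\<close> with \<open>v j\<close> fixed.\<close>
  have "(\<Sum>a\<in>UNIV. \<Sum>b\<in>UNIV. (column a S \<bullet> column b T)\<^sup>2) =
      (\<Sum>a\<in>UNIV. \<Sum>j\<in>?I. (column a S \<bullet> v j)\<^sup>2)"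
    using span_v unfolding columns_eq_range
    by (intro sum.cong refl sum_inner_square_basis_independent[OF on_T _ on_v]) auto
  also have "\<dots> = (\<Sum>j\<in>?I. \<Sum>a\<in>UNIV. (v j \<bullet> column a S)\<^sup>2)"
    by (subst sum.swap) (simp add: inner_commute)
  also have "\<dots> = (\<Sum>j\<in>?I. \<Sum>i\<in>?I. (v j \<bullet> u i)\<^sup>2)"
    using span_u unfolding columns_eq_range
    by (intro sum.cong refl sum_inner_square_basis_independent[OF on_S _ on_u]) auto
  also have "\<dots> = (\<Sum>j\<in>?I. \<Sum>i\<in>?I. if i = j then (cos (\<theta> i))\<^sup>2 else 0)"
    by (intro sum.cong refl) (simp add: cross)
  also have "\<dots> = (\<Sum>j\<in>?I. (cos (\<theta> j))\<^sup>2)"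
    by simp
  finally show ?thesis
    by (simp add: sin_squared_eq sum_subtractf)
qed

section \<open>Existence of principal vectors and principal angles\<close>

text \<open>Fewer than \<open>dim U\<close> vectors cannot span \<open>U\<close>, so some nonzero
  vector of \<open>U\<close> is orthogonal to their span; it is then normalised.\<close>

lemma exists_unit_orthogonal:
  fixes U :: "'a::euclidean_space set"
  assumes "subspace U" and "finite A" and "A \<subseteq> U" and "card A < dim U"
  obtains x where "x \<in> U" and "x \<bullet> x = 1" and "\<And>y. y \<in> A \<Longrightarrow> x \<bullet> y = 0"
proof -
  have "span A \<noteq> U"
    using dim_le_card'[OF assms(2)] assms(4) by (metis dim_span not_le)
  then have "span A \<subset> span U"
    using assms(1,3) by (metis psubsetI span_eq_iff span_mono)
  then obtain x where x: "x \<noteq> 0" "x \<in> span U" "\<And>y. y \<in> span A \<Longrightarrow> orthogonal x y"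
    using orthogonal_to_subspace_exists_gen by blast
  show thesis
  proof
    show "sgn x \<in> U"
      using x(2) assms(1) by (simp add: sgn_div_norm span_eq_iff[THEN iffD2] subspace_scale)
    show "sgn x \<bullet> sgn x = 1"
      using x(1) norm_sgn[of x] by (simp add: norm_eq_1)
    show "sgn x \<bullet> y = 0" if "y \<in> A" for y
      using x(3)[of y] that by (simp add: sgn_div_norm orthogonal_def span_base)
  qed
qed

text \<open>A product of two unit spheres of subspaces, cut by closed orthogonality conditions.
  Compactness makes the maximum of the inner product attained.\<close>

lemma compact_feasible_pairs:
  fixes U :: "'a::euclidean_space set"
  assumes "subspace U" and "subspace V"
  shows "compact (feasible_pairs U V u v i)"
proof -
  have "closed {p. fst p \<bullet> u j = 0 \<and> snd p \<bullet> v j = (0::real)}" for j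
    by (intro closed_Collect_conj closed_Collect_eq continuous_intros)
  then have "closed (\<Inter>j\<in>{1..<i}. {p. fst p \<bullet> u j = 0 \<and> snd p \<bullet> v j = 0})"
    by blast
  moreover have "compact ((U \<inter> sphere 0 1) \<times> (V \<inter> sphere 0 1))"
    using assms by (intro compact_Times closed_Int_compact closed_subspace compact_sphere)
  moreover have "feasible_pairs U V u v i =
      ((U \<inter> sphere 0 1) \<times> (V \<inter> sphere 0 1)) \<inter>
      (\<Inter>j\<in>{1..<i}. {p. fst p \<bullet> u j = 0 \<and> snd p \<bullet> v j = 0})"
    by (auto simp: feasible_pairs_def norm_eq_1)
  ultimately show ?thesis
    by (simp only: compact_Int_closed)
qed

lemma feasible_pairs_nonempty:
  fixes U :: "'a::euclidean_space set"
  assumes "subspace U" and "subspace V" and "1 \<le> i" and "i \<le> dim U" and "i \<le> dim V"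
    and "\<And>j. j \<in> {1..<i} \<Longrightarrow> u j \<in> U \<and> v j \<in> V"
  shows "feasible_pairs U V u v i \<noteq> {}"
proof -
  \<comment> \<open>At most \<open>i - 1\<close> vectors have been chosen before step
    \<open>i\<close>, one fewer than the dimension bound demands.\<close>
  have card: "card (w ` {1..<i}) < i" for w :: "nat \<Rightarrow> 'a"
    using card_image_le[of "{1..<i}" w] assms(3) by simp
  obtain x where "x \<in> U" "x \<bullet> x = 1" "\<And>y. y \<in> u ` {1..<i} \<Longrightarrow> x \<bullet> y = 0"
    using exists_unit_orthogonal[of U "u ` {1..<i}"] assms card[of u] by (auto simp: image_subset_iff)
  moreover obtain y where "y \<in> V" "y \<bullet> y = 1" "\<And>z. z \<in> v ` {1..<i} \<Longrightarrow> y \<bullet> z = 0"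
    using exists_unit_orthogonal[of V "v ` {1..<i}"] assms card[of v] by (auto simp: image_subset_iff)
  ultimately have "(x, y) \<in> feasible_pairs U V u v i"
    by (simp add: feasible_pairs_def)
  then show ?thesis
    by blast
qed

text \<open>The constraints of step \<open>i\<close> look only at earlier vectors, which is what
  permits choosing the vectors by recursion on \<open>i\<close>.\<close>

lemma feasible_pairs_cong:
  assumes "\<And>j. j < i \<Longrightarrow> u j = u' j \<and> v j = v' j"
  shows "feasible_pairs U V u v i = feasible_pairs U V u' v' i"
  using assms by (auto simp: feasible_pairs_def)

text \<open>Greedy choice: at each step the feasible set is nonempty and compact, so a maximising
  pair exists. The dependence on all earlier choices is handled by well-founded dependent
  choice.\<close>

lemma principal_vectors_exist:
  fixes U :: "'a::euclidean_space set"
  assumes subsp: "subspace U" "subspace V" and dims: "s \<le> dim U" "s \<le> dim V"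
  obtains u v where "\<forall>i\<in>{1..s}. (u i, v i) \<in> feasible_pairs U V u v i"
    and "\<forall>i\<in>{1..s}. \<forall>(x, y)\<in>feasible_pairs U V u v i. x \<bullet> y \<le> u i \<bullet> v i"
proof -
  \<comment> \<open>The choice principle yields a single function, so \<open>u\<close> and
    \<open>v\<close> are packed into one sequence \<open>w\<close> of pairs.\<close>
  define F where "F w i = feasible_pairs U V (fst \<circ> w) (snd \<circ> w) i" for w i
  \<comment> \<open>Outside \<open>{1..s}\<close> any pair is acceptable, so that the choice can be
    made at every natural number.\<close>
  define P where "P w i r \<longleftrightarrow>
      (i \<in> {1..s} \<longrightarrow> r \<in> F w i \<and> (\<forall>p\<in>F w i. fst p \<bullet> snd p \<le> fst r \<bullet> snd r))" for w i r
  have "\<exists>w. \<forall>i. P w i (w i)"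
  proof (rule dependent_wellorder_choice)
    fix r and w w' :: "nat \<Rightarrow> 'a \<times> 'a" and i :: nat
    assume "\<And>j. j < i \<Longrightarrow> w j = w' j"
    then have "F w i = F w' i"
      unfolding F_def by (intro feasible_pairs_cong) simp
    then show "P w i r = P w' i r"
      by (simp add: P_def)
  next
    fix i :: nat and w
    assume IH: "\<And>j. j < i \<Longrightarrow> P w j (w j)"
    show "\<exists>r. P w i r"
    proof (cases "i \<in> {1..s}")
      case True
      have "fst (w j) \<in> U \<and> snd (w j) \<in> V" if "j \<in> {1..<i}" for j
        using IH[of j] that True by (auto simp: P_def F_def feasible_pairs_def)
      then have "F w i \<noteq> {}"
        unfolding F_def using True dims subsp by (intro feasible_pairs_nonempty) auto
      moreover have "compact (F w i)"
        unfolding F_def using subsp by (rule compact_feasible_pairs)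
      moreover have "continuous_on (F w i) (\<lambda>p. fst p \<bullet> snd p)"
        by (intro continuous_intros)
      ultimately show ?thesis
        unfolding P_def using continuous_attains_sup by blast
    next
      case False
      then show ?thesis
        unfolding P_def by blast
    qed
  qed
  then obtain w where w: "\<And>i. P w i (w i)"
    by blast
  show thesis
  proof (rule that[of "fst \<circ> w" "snd \<circ> w"])
    show "\<forall>i\<in>{1..s}. ((fst \<circ> w) i, (snd \<circ> w) i) \<in> feasible_pairs U V (fst \<circ> w) (snd \<circ> w) i"
      using w by (simp add: P_def F_def)
    show "\<forall>i\<in>{1..s}. \<forall>(x, y)\<in>feasible_pairs U V (fst \<circ> w) (snd \<circ> w) i.
        x \<bullet> y \<le> (fst \<circ> w) i \<bullet> (snd \<circ> w) i"
      using w by (fastforce simp: P_def F_def)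
  qed
qed

lemma principal_angles_exist:
  fixes U :: "'a::euclidean_space set"
  assumes subsp: "subspace U" "subspace V" and dims: "s \<le> dim U" "s \<le> dim V"
  obtains \<theta> where "principal_angles s U V \<theta>"
proof -
  obtain u v where uv: "\<forall>i\<in>{1..s}. (u i, v i) \<in> feasible_pairs U V u v i"
    "\<forall>i\<in>{1..s}. \<forall>(x, y)\<in>feasible_pairs U V u v i. x \<bullet> y \<le> u i \<bullet> v i"
    using principal_vectors_exist[OF assms] by blast
  have nonneg: "0 \<le> u i \<bullet> v i" if "i \<in> {1..s}" for i
  proof -
    \<comment> \<open>Changing the sign of \<open>u i\<close> keeps feasibility, so maximality gives
      \<open>- (u i \<bullet> v i) \<le> u i \<bullet> v i\<close>. Nonnegativity puts the angle
      \<open>arccos (u i \<bullet> v i)\<close> below \<open>pi / 2\<close>.\<close>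
    have "(- u i, v i) \<in> feasible_pairs U V u v i"
      using uv(1) that subsp by (auto simp: feasible_pairs_def subspace_neg)
    then show ?thesis
      using uv(2) that by fastforce
  qed
  have le1: "u i \<bullet> v i \<le> 1" if "i \<in> {1..s}" for i
  proof -
    have "norm (u i) = 1" "norm (v i) = 1"
      using uv(1) that by (auto simp: feasible_pairs_def norm_eq_1)
    then show ?thesis
      using norm_cauchy_schwarz[of "u i" "v i"] by simp
  qed
  have "principal_angles s U V (\<lambda>i. arccos (u i \<bullet> v i))"
    unfolding principal_angles_def
  proof (intro exI ballI conjI)
    fix i
    assume i: "i \<in> {1..s}"
    show "0 \<le> arccos (u i \<bullet> v i)" "arccos (u i \<bullet> v i) \<le> pi / 2"
      "cos (arccos (u i \<bullet> v i)) = u i \<bullet> v i"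
      using nonneg[OF i] le1[OF i] by (simp_all add: arccos_lbound arccos_le_pi2 del: le_divide_eq_numeral1)
    show "(u i, v i) \<in> feasible_pairs U V u v i"
      using uv(1) i by blast
    show "case p of (x, y) \<Rightarrow> x \<bullet> y \<le> u i \<bullet> v i" if "p \<in> feasible_pairs U V u v i" for p
      using uv(2) i that by blast
  qed
  then show thesis
    by (rule that)
qed

section \<open>The chordal distance and the comparison\<close>

text \<open>The description in \<open>d_chord\<close> is proper: some \<open>\<theta>\<close>
  exists, and every admissible \<open>\<theta>\<close> gives the same sum, as that sum is determined
  by \<open>S\<close> and \<open>T\<close>.\<close>

lemma d_chord_eq:
  fixes S T :: "real ^ 's ^ 'n"
  assumes S: "S \<in> stiefel" and T: "T \<in> stiefel"
  shows "d_chord S T =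
         sqrt (real CARD('s) - (\<Sum>a\<in>UNIV. \<Sum>b\<in>UNIV. (column a S \<bullet> column b T)\<^sup>2))"
proof -
  obtain \<theta> where "principal_angles CARD('s) (span (columns S)) (span (columns T)) \<theta>"
    using principal_angles_exist[of "span (columns S)" "span (columns T)" "CARD('s)"]
      stiefel_dim_span_columns[OF S] stiefel_dim_span_columns[OF T] by auto
  then show ?thesis
    unfolding d_chord_def using sum_sin_square_principal_angles[OF S T]
    by (intro the_equality) auto
qed

theorem theorem4:
  fixes F\<^sub>i F\<^sub>j :: "real ^ 's ^ 'n"
  assumes "1 \<le> CARD('s)" and "CARD('s) \<le> CARD('n)"
    and "F\<^sub>i \<in> stiefel" and "F\<^sub>j \<in> stiefel"
  shows "d_cone F\<^sub>i F\<^sub>j = sqrt 2 * d_chord F\<^sub>i F\<^sub>j"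
  using assms(3,4) by (simp only: d_cone_eq d_chord_eq real_sqrt_mult)

end
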